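(* For integers $a \geq 2$ and $n \geq a^2+1$ we have $$t_{n,a} - \left\lfloor \frac{n}{a} \right\rfloor \binom{a}{2} \leq \mathrm{mex}(n;a) \leq t_{n,a} - 1.$$ Thus, for fixed $a \ge 2$, $\mathrm{mex}(n;a) \sim \left(1 - \frac{1}{a}\right)\frac{n^2}{2}$ as $n \to \infty$.
   Context: All graphs are finite, simple and undirected; the order of a graph is its number of vertices and its size is its number of edges. A monophonic path is an induced (chordless) path. A set $S$ of vertices of a graph $G$ is in monophonic position if no monophonic path of $G$ contains more than two elements of $S$; the monophonic position number (mp-number) $\mathrm{mp}(G)$ is the largest size of such a set. For $a \geq 2$ and $n \geq a$, $\mathrm{mex}(n;a)$ is the largest possible size of a graph with order $n$ and mp-number $a$. $T_{n,a}$ denotes the Turán graph, i.e. the complete $a$-partite graph of order $n$ with every partite set of size $\lfloor n/a \rfloor$ or $\lceil n/a \rceil$, and $t_{n,a}$ is its size. *)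

theory Defs
  imports Complex_Main "HOL-Library.Disjoint_Sets" "HOL-Library.Landau_Symbols"
begin

record 'a ugraph =
  verts :: "'a set"
  edges :: "'a set set"

definition simple_graph :: "'a ugraph \<Rightarrow> bool" where
  "simple_graph G \<longleftrightarrow> finite (verts G) \<and> (\<forall>e \<in> edges G. e \<subseteq> verts G \<and> card e = 2)"

definition graph_order :: "'a ugraph \<Rightarrow> nat" where
  "graph_order G = card (verts G)"

definition graph_size :: "'a ugraph \<Rightarrow> nat" where
  "graph_size G = card (edges G)"

definition is_path :: "'a ugraph \<Rightarrow> 'a list \<Rightarrow> bool" where
  "is_path G p \<longleftrightarrow> p \<noteq> [] \<and> distinct p \<and> set p \<subseteq> verts G \<and>
     (\<forall>i. i + 1 < length p \<longrightarrow> {p ! i, p ! (i + 1)} \<in> edges G)"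

definition monophonic_path :: "'a ugraph \<Rightarrow> 'a list \<Rightarrow> bool" where
  "monophonic_path G p \<longleftrightarrow> is_path G p \<and>
     (\<forall>i j. i + 1 < j \<and> j < length p \<longrightarrow> {p ! i, p ! j} \<notin> edges G)"

definition monophonic_position :: "'a ugraph \<Rightarrow> 'a set \<Rightarrow> bool" where
  "monophonic_position G S \<longleftrightarrow> S \<subseteq> verts G \<and>
     (\<forall>p. monophonic_path G p \<longrightarrow> card (set p \<inter> S) \<le> 2)"

definition mp :: "'a ugraph \<Rightarrow> nat" where
  "mp G = Max {card S | S. monophonic_position G S}"

text \<open>Vertices are taken to be natural numbers; this is no restriction, as every finite
  graph is isomorphic to one with vertex set in \<open>nat\<close>.\<close>

definition mex :: "nat \<Rightarrow> nat \<Rightarrow> nat" where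
  "mex n a = Max {graph_size G | G :: nat ugraph.
     simple_graph G \<and> graph_order G = n \<and> mp G = a}"

definition complete_multipartite :: "'a ugraph \<Rightarrow> 'a set set \<Rightarrow> bool" where
  "complete_multipartite G P \<longleftrightarrow> simple_graph G \<and> partition_on (verts G) P \<and>
     edges G = {{u, v} | u v. u \<in> verts G \<and> v \<in> verts G \<and> \<not> (\<exists>X \<in> P. u \<in> X \<and> v \<in> X)}"

text \<open>Parts of a \<open>partition_on\<close> are nonempty, so this is meaningful for \<open>1 \<le> a \<le> n\<close>.\<close>

definition turan_graph :: "nat \<Rightarrow> nat \<Rightarrow> 'a ugraph \<Rightarrow> bool" where
  "turan_graph n a G \<longleftrightarrow> graph_order G = n \<and>
     (\<exists>P. complete_multipartite G P \<and> card P = a \<and>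
        (\<forall>X \<in> P. int (card X) = \<lfloor>real n / real a\<rfloor> \<or> int (card X) = \<lceil>real n / real a\<rceil>))"

text \<open>Well defined by \<open>turan_graph_exists\<close> and \<open>turan_graph_size\<close> below.\<close>

definition turan_size :: "nat \<Rightarrow> nat \<Rightarrow> nat" where
  "turan_size n a = (THE t. \<exists>G :: nat ugraph. turan_graph n a G \<and> graph_size G = t)"

lemma complete_multipartite_size:
  assumes "complete_multipartite G P"
  shows "graph_size G + (\<Sum>X\<in>P. card X choose 2) = graph_order G choose 2"
proof -
  let ?V = "verts G"
  let ?K = "\<lambda>X. {e. e \<subseteq> X \<and> card e = 2}"
  from assms have fin: "finite ?V" and P: "partition_on ?V P"
    and E: "edges G = {{u, v} | u v. u \<in> ?V \<and> v \<in> ?V \<and> \<not> (\<exists>X \<in> P. u \<in> X \<and> v \<in> X)}"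
    and e2: "\<And>e. e \<in> edges G \<Longrightarrow> e \<subseteq> ?V \<and> card e = 2"
    by (auto simp: complete_multipartite_def simple_graph_def)
  have un: "\<Union>P = ?V" using P by (simp add: partition_on_def)
  have finP: "finite P" using fin P by (rule finite_elements)
  have finX: "\<And>X. X \<in> P \<Longrightarrow> finite X" by (rule finite_subset[OF _ fin]) (use un in blast)
  have finK: "finite (?K ?V)" using fin by simp
  have "?K ?V = edges G \<union> (\<Union>X\<in>P. ?K X)"
  proof (intro equalityI subsetI)
    fix e assume e: "e \<in> ?K ?V"
    then obtain u v where uv: "e = {u, v}" by (auto simp: card_2_iff)
    show "e \<in> edges G \<union> (\<Union>X\<in>P. ?K X)"
    proof (cases "\<exists>X\<in>P. u \<in> X \<and> v \<in> X")
      case True then show ?thesis using e uv by auto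
    next
      case False then have "e \<in> edges G" unfolding E using e uv by auto
      then show ?thesis by simp
    qed
  next
    fix e assume "e \<in> edges G \<union> (\<Union>X\<in>P. ?K X)"
    then show "e \<in> ?K ?V" using e2 un by auto
  qed
  moreover have "edges G \<inter> (\<Union>X\<in>P. ?K X) = {}"
    unfolding E by auto
  moreover have "card (\<Union>X\<in>P. ?K X) = (\<Sum>X\<in>P. card (?K X))"
  proof (rule card_UN_disjoint[OF finP])
    show "\<forall>X\<in>P. finite (?K X)" using finX by simp
    show "\<forall>X\<in>P. \<forall>Y\<in>P. X \<noteq> Y \<longrightarrow> ?K X \<inter> ?K Y = {}"
    proof (intro ballI impI)
      fix X Y assume "X \<in> P" "Y \<in> P" "X \<noteq> Y"
      then have "X \<inter> Y = {}" using P by (meson partition_onD2 disjointD)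
      then show "?K X \<inter> ?K Y = {}" by (auto simp: card_2_iff)
    qed
  qed
  ultimately have "card (?K ?V) = card (edges G) + (\<Sum>X\<in>P. card (?K X))"
    using finK by (simp add: card_Un_disjoint)
  then show ?thesis
    using fin finX by (simp add: n_subsets graph_size_def graph_order_def)
qed

lemma turan_graph_size:
  assumes "a \<ge> 1" and "turan_graph n a G"
  shows "graph_size G + (a * (n div a choose 2) + n div a * (n mod a)) = n choose 2"
proof -
  let ?q = "n div a"
  from assms(2) obtain P where n: "graph_order G = n" and cm: "complete_multipartite G P"
    and cP: "card P = a"
    and X: "\<And>X. X \<in> P \<Longrightarrow> int (card X) = \<lfloor>real n / real a\<rfloor> \<or> int (card X) = \<lceil>real n / real a\<rceil>"
    by (auto simp: turan_graph_def)
  have fl: "\<lfloor>real n / real a\<rfloor> = int ?q" by (simp add: floor_divide_of_nat_eq)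
  have "\<lceil>real n / real a\<rceil> = int ?q \<or> \<lceil>real n / real a\<rceil> = int ?q + 1"
    using fl by linarith
  then have q: "card X = ?q \<or> card X = Suc ?q" if "X \<in> P" for X
    using X[OF that] fl by linarith
  from cm have fin: "finite (verts G)" and P: "partition_on (verts G) P"
    by (auto simp: complete_multipartite_def simple_graph_def)
  have un: "\<Union>P = verts G" using P by (simp add: partition_on_def)
  have finP: "finite P" using fin P by (rule finite_elements)
  have finX: "\<And>X. X \<in> P \<Longrightarrow> finite X" by (rule finite_subset[OF _ fin]) (use un in blast)
  have "n = (\<Sum>X\<in>P. card X)"
    using n product_partition[OF P finX] by (simp add: graph_order_def)
  also have "\<dots> = (\<Sum>X\<in>P. ?q + (card X - ?q))"
    by (rule sum.cong) (use q in fastforce)+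
  also have "\<dots> = a * ?q + (\<Sum>X\<in>P. card X - ?q)"
    using cP by (simp add: sum.distrib)
  finally have r: "(\<Sum>X\<in>P. card X - ?q) = n mod a"
    by (metis add_left_cancel mult_div_mod_eq)
  have "(\<Sum>X\<in>P. card X choose 2) = (\<Sum>X\<in>P. (?q choose 2) + ?q * (card X - ?q))"
  proof (rule sum.cong)
    fix X assume "X \<in> P"
    then show "card X choose 2 = (?q choose 2) + ?q * (card X - ?q)"
      using q[of X] by (auto simp: numeral_2_eq_2)
  qed simp
  also have "\<dots> = a * (?q choose 2) + ?q * (n mod a)"
    using cP r by (simp add: sum.distrib flip: sum_distrib_left)
  finally show ?thesis using complete_multipartite_size[OF cm] n by simp
qed

lemma card_residue_class:
  assumes "i < a"
  shows "card {v. v < n \<and> v mod a = i} = (if i < n mod a then Suc (n div a) else n div a)"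
proof -
  let ?k = "if i < n mod a then Suc (n div a) else n div a"
  have "{v. v < n \<and> v mod a = i} = (\<lambda>j. j * a + i) ` {..<?k}"
  proof (intro equalityI subsetI)
    fix v assume v: "v \<in> {v. v < n \<and> v mod a = i}"
    then have eq: "v = v div a * a + i" using div_mult_mod_eq[of v a] by simp
    have le: "v div a \<le> n div a" using v by (simp add: div_le_mono)
    have "v div a < ?k"
    proof (cases "i < n mod a")
      case False
      have "v div a \<noteq> n div a"
      proof
        assume "v div a = n div a"
        then have "n div a * a + i < n div a * a + n mod a"
          using v eq div_mult_mod_eq[of n a] by simp
        with False show False by simp
      qed
      then show ?thesis using False le by simp
    qed (use le in simp)
    then show "v \<in> (\<lambda>j. j * a + i) ` {..<?k}" using eq by blast
  next
    fix v assume "v \<in> (\<lambda>j. j * a + i) ` {..<?k}"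
    then obtain j where j: "j < ?k" "v = j * a + i" by auto
    have n: "n = n div a * a + n mod a" by simp
    have "v < n"
    proof (cases "j < n div a")
      case True
      then have "Suc j * a \<le> n div a * a" by (intro mult_le_mono1) simp
      moreover have "j * a + i < Suc j * a" using assms by simp
      ultimately show ?thesis using j n by linarith
    next
      case False
      then have "j = n div a \<and> i < n mod a" using j by (auto split: if_splits)
      then have "v = n div a * a + i" "i < n mod a" using j by auto
      then show ?thesis using n by linarith
    qed
    then show "v \<in> {v. v < n \<and> v mod a = i}" using j assms by simp
  qed
  moreover have "inj_on (\<lambda>j. j * a + i) {..<?k}" using assms by (auto simp: inj_on_def)
  ultimately show ?thesis by (simp add: card_image)
qed

lemma turan_graph_exists:
  assumes "1 \<le> a" "a \<le> n"
  shows "turan_graph n a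
    \<lparr>verts = {..<n}, edges = {{u, v} | u v. u < n \<and> v < n \<and> u mod a \<noteq> v mod a}\<rparr>"
proof -
  define C where "C i = {v. v < n \<and> v mod a = i}" for i
  let ?P = "C ` {..<a}"
  have ne: "i \<in> C i" if "i < a" for i using that assms by (simp add: C_def)
  have inj: "inj_on C {..<a}"
  proof (rule inj_onI)
    fix i j assume "i \<in> {..<a}" "j \<in> {..<a}" "C i = C j"
    then have "i \<in> C j" using ne by auto
    then show "i = j" using \<open>i \<in> {..<a}\<close> by (simp add: C_def)
  qed
  have part: "partition_on {..<n} ?P"
  proof (rule partition_onI)
    show "\<Union>?P = {..<n}" using assms by (auto simp: C_def)
  next
    fix X Y assume "X \<in> ?P" "Y \<in> ?P" "X \<noteq> Y"
    then show "disjnt X Y" by (auto simp: C_def disjnt_def)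
  next
    show "{} \<notin> ?P" using ne by auto
  qed
  have same: "(\<exists>X \<in> ?P. u \<in> X \<and> v \<in> X) \<longleftrightarrow> u mod a = v mod a"
    if "u < n" "v < n" for u v
    using that assms by (auto simp: C_def)
  have card: "int (card X) = \<lfloor>real n / real a\<rfloor> \<or> int (card X) = \<lceil>real n / real a\<rceil>"
    if X: "X \<in> ?P" for X
  proof -
    from X obtain i where i: "i < a" "X = C i" by auto
    have fl: "\<lfloor>real n / real a\<rfloor> = int (n div a)" by (simp add: floor_divide_of_nat_eq)
    have "\<lceil>real n / real a\<rceil> = int (n div a) + 1" if "i < n mod a"
    proof -
      have "real n / real a = real (n div a) + real (n mod a) / real a"
        using assms(1) by (simp add: field_simps flip: of_nat_mult of_nat_add)
      moreover have "0 < real (n mod a) / real a" "real (n mod a) / real a < 1"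
        using that assms(1) by simp_all
      ultimately show ?thesis by linarith
    qed
    then show ?thesis using card_residue_class[OF i(1), of n] i(2) fl by (auto simp: C_def)
  qed
  have eqE: "{{u, v} | u v. u < n \<and> v < n \<and> u mod a \<noteq> v mod a} =
      {{u, v} | u v. u \<in> {..<n} \<and> v \<in> {..<n} \<and> \<not> (\<exists>X \<in> ?P. u \<in> X \<and> v \<in> X)}"
    by (intro Collect_cong ex_cong1) (use same in blast)
  have "complete_multipartite
    \<lparr>verts = {..<n}, edges = {{u, v} | u v. u < n \<and> v < n \<and> u mod a \<noteq> v mod a}\<rparr> ?P"
    unfolding complete_multipartite_def simple_graph_def ugraph.simps
    by (intro conjI part eqE) (auto simp: card_insert_if)
  moreover have "card ?P = a" using inj by (simp add: card_image)
  ultimately show ?thesis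
    unfolding turan_graph_def graph_order_def using card by auto
qed

lemma turan_size_eq:
  assumes "1 \<le> a" "a \<le> n" "turan_graph n a (G :: nat ugraph)"
  shows "turan_size n a = graph_size G"
  unfolding turan_size_def
proof (rule the_equality)
  show "\<exists>H :: nat ugraph. turan_graph n a H \<and> graph_size H = graph_size G"
    using assms(3) by blast
next
  fix t assume "\<exists>H :: nat ugraph. turan_graph n a H \<and> graph_size H = t"
  then show "t = graph_size G"
    using turan_graph_size[OF assms(1)] assms(3) by (metis add_right_cancel)
qed

end

theory Submission
  imports Defs "HOL-Real_Asymp.Real_Asymp"
begin

text \<open>
  A clique is in monophonic position, so a graph with mp-number \<open>a\<close> has no clique on \<open>a + 1\<close>
  vertices. Zykov symmetrization shows that a largest graph without such a clique is complete
  multipartite with at most \<open>a\<close> parts, and hence not larger than the Turan graph. A part of a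
  complete multipartite graph is in monophonic position as well, and for \<open>n > a\<^sup>2\<close> some part
  has more than \<open>a\<close> vertices; so the Turan bound is not attained.

  For the lower bound, arrange the vertices of the Turan graph in a grid with the parts as columns
  and delete the edges inside each full row, which are \<open>a choose 2\<close> many. A diagonal is a clique
  on \<open>a\<close> vertices. A set of more than \<open>a\<close> vertices has two in the same column, and explicit induced
  paths with at most five vertices join these to any third vertex.
\<close>

section \<open>Cliques, degrees and Zykov's cloning operation\<close>

definition clique :: "'a ugraph \<Rightarrow> 'a set \<Rightarrow> bool" where
  "clique G K \<longleftrightarrow> K \<subseteq> verts G \<and> (\<forall>x\<in>K. \<forall>y\<in>K. x \<noteq> y \<longrightarrow> {x, y} \<in> edges G)"

definition neighbours :: "'a ugraph \<Rightarrow> 'a \<Rightarrow> 'a set" where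
  "neighbours G v = {y. {v, y} \<in> edges G}"

text \<open>Competitors share the vertex set, not merely the order: cloning preserves the vertex
  set, so no relabelling has to be carried along.\<close>

definition extremal :: "nat \<Rightarrow> 'a ugraph \<Rightarrow> bool" where
  "extremal a G \<longleftrightarrow> simple_graph G \<and> (\<forall>K. clique G K \<longrightarrow> card K \<le> a) \<and>
     (\<forall>H. simple_graph H \<and> verts H = verts G \<and> (\<forall>K. clique H K \<longrightarrow> card K \<le> a) \<longrightarrow>
        graph_size H \<le> graph_size G)"

text \<open>Zykov's operation for a whole set: each vertex of \<open>U\<close> becomes a copy of
  \<open>v\<close>. A set is taken because the transitivity argument replaces two vertices at
  once.\<close>

definition clone :: "'a ugraph \<Rightarrow> 'a \<Rightarrow> 'a set \<Rightarrow> 'a ugraph" where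
  "clone G v U = \<lparr>verts = verts G,
     edges = {e \<in> edges G. e \<inter> U = {}} \<union> {{x, y} | x y. x \<in> U \<and> {v, y} \<in> edges G}\<rparr>"

lemma simple_graph_edgeD:
  assumes "simple_graph G" "{u, v} \<in> edges G"
  shows "u \<in> verts G" "v \<in> verts G" "u \<noteq> v"
  using assms by (auto simp: simple_graph_def)

lemma simple_graph_finite_edges:
  assumes "simple_graph G"
  shows "finite (edges G)"
proof -
  have "edges G \<subseteq> Pow (verts G)" "finite (verts G)"
    using assms by (auto simp: simple_graph_def)
  then show ?thesis by (meson finite_Pow_iff finite_subset)
qed

lemma graph_size_le_choose:
  assumes "simple_graph G"
  shows "graph_size G \<le> graph_order G choose 2"
proof -
  have fin: "finite (verts G)" using assms by (simp add: simple_graph_def)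
  have "edges G \<subseteq> {e. e \<subseteq> verts G \<and> card e = 2}"
    using assms by (auto simp: simple_graph_def)
  then have "card (edges G) \<le> card {e. e \<subseteq> verts G \<and> card e = 2}"
    using fin by (intro card_mono) auto
  then show ?thesis using fin by (simp add: n_subsets graph_size_def graph_order_def)
qed

lemma neighbours_subset:
  assumes "simple_graph G"
  shows "neighbours G v \<subseteq> verts G"
  using assms by (auto simp: neighbours_def dest: simple_graph_edgeD)

lemma finite_neighbours:
  assumes "simple_graph G"
  shows "finite (neighbours G v)"
  using assms finite_subset[OF neighbours_subset[OF assms]] by (simp add: simple_graph_def)

lemma card_incident_edges:
  assumes "simple_graph G"
  shows "card {e \<in> edges G. v \<in> e} = card (neighbours G v)"
proof -
  have "{e \<in> edges G. v \<in> e} = (\<lambda>y. {v, y}) ` neighbours G v"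
  proof (intro equalityI subsetI)
    fix e assume e: "e \<in> {e \<in> edges G. v \<in> e}"
    then have "card e = 2" using assms by (auto simp: simple_graph_def)
    then obtain p q where "e = {p, q}" by (auto simp: card_2_iff)
    then show "e \<in> (\<lambda>y. {v, y}) ` neighbours G v"
      using e by (auto simp: neighbours_def insert_commute)
  qed (auto simp: neighbours_def)
  moreover have "inj_on (\<lambda>y. {v, y}) (neighbours G v)"
    by (auto simp: inj_on_def doubleton_eq_iff)
  ultimately show ?thesis by (simp add: card_image)
qed

lemma simple_graph_clone:
  assumes "simple_graph G" "U \<subseteq> verts G" "neighbours G v \<inter> U = {}"
  shows "simple_graph (clone G v U)"
  unfolding simple_graph_def
proof (intro conjI ballI)
  show "finite (verts (clone G v U))" using assms by (simp add: clone_def simple_graph_def)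
next
  fix e assume "e \<in> edges (clone G v U)"
  then consider "e \<in> edges G" | x y where "e = {x, y}" "x \<in> U" "{v, y} \<in> edges G"
    by (auto simp: clone_def)
  then have "e \<subseteq> verts G \<and> card e = 2"
  proof cases
    case 1 then show ?thesis using assms by (auto simp: simple_graph_def)
  next
    case 2
    then have "x \<noteq> y" using assms by (auto simp: neighbours_def)
    then show ?thesis using 2 assms(2) simple_graph_edgeD[OF assms(1) 2(3)] by auto
  qed
  then show "e \<subseteq> verts (clone G v U)" "card e = 2" by (auto simp: clone_def)
qed

text \<open>All edges meeting \<open>U\<close> are lost, and \<open>card U\<close> copies of the
  neighbourhood of \<open>v\<close> are gained. Adding the loss on the left avoids truncated
  subtraction.\<close>

lemma graph_size_clone:
  assumes "simple_graph G" "U \<subseteq> verts G" "neighbours G v \<inter> U = {}"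
  shows "graph_size (clone G v U) + card {e \<in> edges G. e \<inter> U \<noteq> {}}
    = graph_size G + card U * card (neighbours G v)"
proof -
  let ?A = "{e \<in> edges G. e \<inter> U = {}}" and ?B = "{e \<in> edges G. e \<inter> U \<noteq> {}}"
  let ?N = "neighbours G v"
  let ?C = "(\<lambda>(x, y). {x, y}) ` (U \<times> ?N)"
  have finE: "finite (edges G)" using assms(1) by (rule simple_graph_finite_edges)
  have finU: "finite U" using assms by (meson finite_subset simple_graph_def)
  have finN: "finite ?N" using assms(1) by (rule finite_neighbours)
  have "edges (clone G v U) = ?A \<union> ?C" by (auto simp: clone_def neighbours_def)
  then have "graph_size (clone G v U) = card (?A \<union> ?C)" by (simp add: graph_size_def)
  also have "\<dots> = card ?A + card ?C"
    using finE finU finN by (intro card_Un_disjoint) auto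
  also have "card ?C = card U * card ?N"
  proof -
    \<comment> \<open>No neighbour of \<open>v\<close> lies in \<open>U\<close>, so the unordered
      pair \<open>{x, y}\<close> reveals which end is the copy.\<close>
    have "inj_on (\<lambda>(x, y). {x, y}) (U \<times> ?N)"
      using assms(3) by (auto simp: inj_on_def doubleton_eq_iff)
    then show ?thesis by (simp add: card_image card_cartesian_product)
  qed
  finally have "graph_size (clone G v U) = card ?A + card U * card ?N" .
  moreover have "graph_size G = card ?A + card ?B"
  proof -
    have "edges G = ?A \<union> ?B" by auto
    then have "graph_size G = card (?A \<union> ?B)" by (simp add: graph_size_def)
    also have "\<dots> = card ?A + card ?B"
      using finE by (intro card_Un_disjoint) auto
    finally show ?thesis .
  qed
  ultimately show ?thesis by simp
qed

text \<open>A clique of the clone meets the independent set \<open>U\<close> at most once, and that vertex can be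
  exchanged for \<open>v\<close>.\<close>

lemma clique_clone:
  assumes G: "simple_graph G" "v \<in> verts G" "v \<notin> U" "neighbours G v \<inter> U = {}"
    and K: "clique (clone G v U) K"
  shows "\<exists>K'. clique G K' \<and> card K' = card K"
proof (cases "K \<inter> U = {}")
  case True
  have "clique G K"
    unfolding clique_def
  proof (intro conjI ballI impI)
    show "K \<subseteq> verts G" using K by (simp add: clique_def clone_def)
    fix x y assume "x \<in> K" "y \<in> K" "x \<noteq> y"
    then have "{x, y} \<in> edges (clone G v U)" using K by (simp add: clique_def)
    then show "{x, y} \<in> edges G"
      using True \<open>x \<in> K\<close> \<open>y \<in> K\<close> by (auto simp: clone_def doubleton_eq_iff)
  qed
  then show ?thesis by blast
next
  case False
  then obtain x where x: "x \<in> K" "x \<in> U" by blast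
  have KV: "K \<subseteq> verts G" using K by (simp add: clique_def clone_def)
  then have finK: "finite K" using G(1) by (meson finite_subset simple_graph_def)
  have N: "y \<in> neighbours G v" if "y \<in> K" "y \<noteq> x" for y
  proof -
    have "{x, y} \<in> edges (clone G v U)" using K x that by (auto simp: clique_def)
    then obtain x' y' where "{x, y} = {x', y'}" "x' \<in> U" "{v, y'} \<in> edges G"
      using x by (auto simp: clone_def)
    then show ?thesis using x G(4) by (auto simp: neighbours_def doubleton_eq_iff)
  qed
  have nU: "y \<notin> U" if "y \<in> K" "y \<noteq> x" for y using N[OF that] G(4) by blast
  have nv: "v \<notin> K - {x}" using N G(1) by (auto simp: neighbours_def dest: simple_graph_edgeD)
  have E: "{y, z} \<in> edges G" if "y \<in> K - {x}" "z \<in> K - {x}" "y \<noteq> z" for y z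
  proof -
    have "{y, z} \<in> edges (clone G v U)" using K that by (auto simp: clique_def)
    then show ?thesis using nU that by (auto simp: clone_def doubleton_eq_iff)
  qed
  have "clique G (insert v (K - {x}))"
    unfolding clique_def using KV G(2) E N
    by (auto simp: neighbours_def insert_commute)
  moreover have "card (insert v (K - {x})) = card K"
    using nv x finK by (metis card_Suc_Diff1 card_insert_disjoint finite_Diff)
  ultimately show ?thesis by blast
qed

section \<open>Structure of the extremal graphs\<close>

text \<open>Cloning creates no larger clique, so by maximality its gain cannot exceed its
  loss.\<close>

lemma extremal_clone_le:
  assumes ext: "extremal a G" and U: "U \<subseteq> verts G" "v \<in> verts G" "v \<notin> U" "neighbours G v \<inter> U = {}"
  shows "card U * card (neighbours G v) \<le> card {e \<in> edges G. e \<inter> U \<noteq> {}}"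
proof -
  have G: "simple_graph G" using ext by (simp add: extremal_def)
  have "\<forall>K. clique (clone G v U) K \<longrightarrow> card K \<le> a"
    using clique_clone[OF G U(2-4)] ext by (metis extremal_def)
  then have "graph_size (clone G v U) \<le> graph_size G"
    using ext simple_graph_clone[OF G U(1,4)] by (simp add: extremal_def clone_def)
  then show ?thesis using graph_size_clone[OF G U(1,4)] by linarith
qed

text \<open>If the degrees differed, turning the vertex of smaller degree into a copy of the other
  would gain edges.\<close>

lemma extremal_nonadjacent_degree:
  assumes ext: "extremal a G" and uv: "u \<in> verts G" "v \<in> verts G" "{u, v} \<notin> edges G"
  shows "card (neighbours G u) = card (neighbours G v)"
proof -
  have G: "simple_graph G" using ext by (simp add: extremal_def)
  have le: "card (neighbours G y) \<le> card (neighbours G x)"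
    if "x \<in> verts G" "y \<in> verts G" "x \<noteq> y" "{y, x} \<notin> edges G" for x y
    using extremal_clone_le[OF ext, of "{x}" y] that card_incident_edges[OF G, of x]
    by (simp add: neighbours_def)
  show ?thesis
    using le[of u v] le[of v u] uv by (cases "u = v") (auto simp: insert_commute)
qed

text \<open>Suppose \<open>uw\<close> is an edge while \<open>v\<close> is adjacent to neither end.
  All three have a common degree \<open>d\<close>. Turning both \<open>u\<close> and
  \<open>w\<close> into copies of \<open>v\<close> destroys only \<open>2d - 1\<close> edges, as the
  degree sum counts \<open>uw\<close> twice, but creates \<open>2d\<close>.\<close>

lemma extremal_nonadjacent_trans:
  assumes ext: "extremal a G"
    and V: "u \<in> verts G" "v \<in> verts G" "w \<in> verts G"
    and uv: "{u, v} \<notin> edges G" and vw: "{v, w} \<notin> edges G"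
  shows "{u, w} \<notin> edges G"
proof
  assume uw: "{u, w} \<in> edges G"
  have G: "simple_graph G" using ext by (simp add: extremal_def)
  have ne: "u \<noteq> w" "v \<noteq> u" "v \<noteq> w"
    using simple_graph_edgeD[OF G uw] uv vw uw by (auto simp: insert_commute)
  let ?I = "\<lambda>x. {e \<in> edges G. x \<in> e}"
  have finE: "finite (edges G)" using G by (rule simple_graph_finite_edges)
  have "?I u \<inter> ?I w = {{u, w}}"
  proof (intro equalityI subsetI)
    fix e assume e: "e \<in> ?I u \<inter> ?I w"
    then have "card e = 2" using G by (auto simp: simple_graph_def)
    then obtain p q where "e = {p, q}" by (auto simp: card_2_iff)
    then show "e \<in> {{u, w}}" using e ne by auto
  qed (use uw in auto)
  then have "card (?I u \<union> ?I w) + 1 = card (?I u) + card (?I w)"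
    using card_Un_Int[of "?I u" "?I w"] finE by simp
  moreover have "{e \<in> edges G. e \<inter> {u, w} \<noteq> {}} = ?I u \<union> ?I w" by auto
  ultimately have "card {e \<in> edges G. e \<inter> {u, w} \<noteq> {}} + 1
      = card (neighbours G u) + card (neighbours G w)"
    by (simp add: card_incident_edges[OF G])
  moreover have "card {u, w} * card (neighbours G v) \<le> card {e \<in> edges G. e \<inter> {u, w} \<noteq> {}}"
    using V uv vw ne
    by (intro extremal_clone_le[OF ext]) (auto simp: neighbours_def insert_commute)
  moreover have "card {u, w} = 2" using ne by simp
  ultimately show False
    using extremal_nonadjacent_degree[OF ext V(1,2) uv]
      extremal_nonadjacent_degree[OF ext V(2,3) vw] by simp
qed

text \<open>Nonadjacency is an equivalence relation, and its classes are the parts. One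
  representative from each class gives a clique, so there are at most \<open>a\<close>
  classes.\<close>

lemma extremal_complete_multipartite:
  assumes ext: "extremal a G"
  obtains P where "complete_multipartite G P" "card P \<le> a"
proof -
  have G: "simple_graph G" using ext by (simp add: extremal_def)
  let ?r = "{(u, v). u \<in> verts G \<and> v \<in> verts G \<and> {u, v} \<notin> edges G}"
  define P where "P = verts G // ?r"
  have irr: "{u} \<notin> edges G" for u using simple_graph_edgeD(3)[OF G, of u u] by auto
  have eq: "equiv (verts G) ?r"
  proof (rule equivI)
    show "?r \<subseteq> verts G \<times> verts G" by auto
    show "refl_on (verts G) ?r" using irr by (auto simp: refl_on_def)
    show "sym ?r" by (auto simp: sym_def insert_commute)
    show "trans ?r" using extremal_nonadjacent_trans[OF ext] unfolding trans_def by blast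
  qed
  have part: "partition_on (verts G) P" unfolding P_def using eq by (rule partition_on_quotient)
  have same: "(\<exists>X\<in>P. u \<in> X \<and> v \<in> X) \<longleftrightarrow> {u, v} \<notin> edges G"
    if "u \<in> verts G" "v \<in> verts G" for u v
  proof
    assume "\<exists>X\<in>P. u \<in> X \<and> v \<in> X"
    then obtain X where X: "X \<in> P" "u \<in> X" "v \<in> X" by blast
    then have "(u, v) \<in> ?r" using quotient_eq_iff[OF eq X(1,1)[unfolded P_def] X(2,3)] by blast
    then show "{u, v} \<notin> edges G" by simp
  next
    assume "{u, v} \<notin> edges G"
    then have "u \<in> ?r `` {u}" "v \<in> ?r `` {u}" using that irr by auto
    then show "\<exists>X\<in>P. u \<in> X \<and> v \<in> X"
      unfolding P_def by (intro bexI[OF _ quotientI[OF that(1)]] conjI)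
  qed
  have "edges G = {{u, v} | u v. u \<in> verts G \<and> v \<in> verts G \<and> {u, v} \<in> edges G}"
  proof (intro equalityI subsetI)
    fix e assume e: "e \<in> edges G"
    then have "card e = 2" "e \<subseteq> verts G" using G by (auto simp: simple_graph_def)
    then show "e \<in> {{u, v} | u v. u \<in> verts G \<and> v \<in> verts G \<and> {u, v} \<in> edges G}"
      using e by (auto simp: card_2_iff)
  qed auto
  also have "\<dots> = {{u, v} | u v. u \<in> verts G \<and> v \<in> verts G \<and> \<not> (\<exists>X\<in>P. u \<in> X \<and> v \<in> X)}"
    by (intro Collect_cong ex_cong1) (use same in blast)
  finally have cm: "complete_multipartite G P"
    using G part by (simp add: complete_multipartite_def)
  have rep: "(SOME x. x \<in> X) \<in> X" if "X \<in> P" for X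
    using that partition_onD3[OF part] by (auto simp: some_in_eq)
  let ?f = "\<lambda>X. SOME x. x \<in> X"
  have sub: "X \<subseteq> verts G" if "X \<in> P" for X using that part by (auto simp: partition_on_def)
  have disj: "X = Y" if "X \<in> P" "Y \<in> P" "x \<in> X" "x \<in> Y" for X Y x
    using that disjointD[OF partition_onD2[OF part]] by blast
  have nadj: "X = Y" if XY: "X \<in> P" "Y \<in> P" "x \<in> X" "y \<in> Y" "{x, y} \<notin> edges G"
    for X Y x y
  proof -
    have "x \<in> verts G" "y \<in> verts G" using sub that by auto
    then obtain Z where "Z \<in> P" "x \<in> Z" "y \<in> Z" using same XY(5) by blast
    then show ?thesis using disj XY by metis
  qed
  have "clique G (?f ` P)"
    unfolding clique_def
  proof (intro conjI ballI impI)
    show "?f ` P \<subseteq> verts G" using rep sub by blast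
    fix x y assume "x \<in> ?f ` P" "y \<in> ?f ` P" "x \<noteq> y"
    then obtain X Y where "X \<in> P" "Y \<in> P" "x = ?f X" "y = ?f Y" by blast
    then show "{x, y} \<in> edges G" using nadj[of X Y x y] rep \<open>x \<noteq> y\<close> by blast
  qed
  then have "card (?f ` P) \<le> a" using ext by (simp add: extremal_def)
  moreover have "inj_on ?f P"
    by (rule inj_onI) (use rep disj in metis)
  ultimately have "card P \<le> a" by (simp add: card_image)
  with cm show thesis by (rule that)
qed

section \<open>Turan's bound for complete multipartite graphs\<close>

text \<open>The graph of \<open>c choose 2\<close> lies above its chord between \<open>q\<close> and \<open>q + 1\<close>.\<close>

lemma choose_two_tangent: "int q * int c + int (q choose 2) - int q * int q \<le> int (c choose 2)"
proof -
  have c2: "2 * int (m choose 2) = int m * (int m - 1)" for m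
    by (induction m) (auto simp: numeral_2_eq_2 algebra_simps)
  \<comment> \<open>Twice the claim rearranges to this: a product of two consecutive integers is
    nonnegative.\<close>
  have "0 \<le> (int c - int q) * (int c - int q - 1)"
    by (cases "int c \<le> int q") (auto intro: mult_nonneg_nonneg mult_nonpos_nonpos)
  then have "2 * (int q * int c + int (q choose 2) - int q * int q) \<le> 2 * int (c choose 2)"
    using c2[of c] c2[of q] by (simp add: algebra_simps)
  then show ?thesis by simp
qed

text \<open>The missing edges are the pairs inside parts. Summing the chord bound at
  \<open>q = n div a\<close> over all parts bounds their number from below by that of the Turan
  graph.\<close>

lemma complete_multipartite_size_le_turan:
  fixes G :: "'a ugraph"
  assumes a: "1 \<le> a" "a \<le> n" and G: "complete_multipartite G P" "card P \<le> a" "graph_order G = n"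
  shows "graph_size G \<le> turan_size n a"
proof -
  let ?q = "n div a"
  have fin: "finite (verts G)" and P: "partition_on (verts G) P"
    using G by (auto simp: complete_multipartite_def simple_graph_def)
  have finX: "finite X" if "X \<in> P" for X
    using that fin P by (auto simp: partition_on_def intro: finite_subset)
  have sum: "(\<Sum>X\<in>P. card X) = n"
    using product_partition[OF P finX] G(3) by (simp add: graph_order_def)
  \<comment> \<open>The chord bound at \<open>c = 0\<close> makes the second factor nonnegative, so
    that fewer than \<open>a\<close> parts can be treated like \<open>a\<close> parts.\<close>
  have "int (card P) * (int ?q * int ?q - int (?q choose 2))
      \<le> int a * (int ?q * int ?q - int (?q choose 2))"
    using G(2) choose_two_tangent[of ?q 0]
    by (intro mult_right_mono) (auto simp: binomial_eq_0)
  then have "int ?q * int n - int a * (int ?q * int ?q - int (?q choose 2))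
      \<le> int ?q * int n - int (card P) * (int ?q * int ?q - int (?q choose 2))" by simp
  also have "\<dots> = (\<Sum>X\<in>P. int ?q * int (card X) + int (?q choose 2) - int ?q * int ?q)"
    unfolding sum[symmetric]
    by (simp add: sum.distrib sum_subtractf sum_distrib_left sum_distrib_right algebra_simps)
  also have "\<dots> \<le> (\<Sum>X\<in>P. int (card X choose 2))"
    by (intro sum_mono choose_two_tangent)
  finally have "int a * int (?q choose 2) + int ?q * (int n - int a * int ?q)
      \<le> int (\<Sum>X\<in>P. card X choose 2)"
    by (simp add: algebra_simps)
  moreover have "int n - int a * int ?q = int (n mod a)"
    by (metis add_diff_cancel_left' mult_div_mod_eq of_nat_add of_nat_mult)
  ultimately have "int (a * (?q choose 2) + ?q * (n mod a)) \<le> int (\<Sum>X\<in>P. card X choose 2)"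
    by simp
  then have "a * (?q choose 2) + ?q * (n mod a) \<le> (\<Sum>X\<in>P. card X choose 2)"
    by (simp only: of_nat_le_iff)
  moreover note complete_multipartite_size[OF G(1)] G(3)
    turan_graph_size[OF a(1) turan_graph_exists[OF a]] turan_size_eq[OF a turan_graph_exists[OF a]]
  ultimately show ?thesis by simp
qed

section \<open>Sets in monophonic position\<close>

lemma three_le_card_obtain:
  fixes A :: "'a :: linorder set"
  assumes "\<not> card A \<le> 2"
  obtains i j k where "i \<in> A" "j \<in> A" "k \<in> A" "i < j" "j < k"
proof -
  have "3 \<le> card A" using assms by simp
  then obtain B where B: "B \<subseteq> A" "card B = 3"
    by (meson obtain_subset_with_card_n)
  then obtain x y z where xyz: "B = {x, y, z}" "x \<noteq> y" "x \<noteq> z" "y \<noteq> z"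
    by (auto simp: card_3_iff)
  then have "x \<in> A" "y \<in> A" "z \<in> A" using B by auto
  then show thesis
    using that xyz(2-4) by (metis linorder_less_linear)
qed

text \<open>A violation of monophonic position becomes three increasing indices. The outer two are
  not consecutive, so an edge between those vertices would be a chord.\<close>

lemma three_on_path:
  assumes "distinct p" "\<not> card (set p \<inter> S) \<le> 2"
  obtains i j k where "i < j" "j < k" "k < length p" "p ! i \<in> S" "p ! j \<in> S" "p ! k \<in> S"
proof -
  let ?A = "{i. i < length p \<and> p ! i \<in> S}"
  have "(!) p ` ?A = set p \<inter> S" by (auto simp: in_set_conv_nth)
  moreover have "inj_on ((!) p) ?A" using assms(1) by (auto simp: inj_on_def nth_eq_iff_index_eq)
  ultimately have "card ?A = card (set p \<inter> S)" by (metis card_image)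
  then show thesis
    using three_le_card_obtain[of ?A] assms(2) that by (metis (mono_tags, lifting) mem_Collect_eq)
qed

text \<open>The first and last of three clique vertices on a path would be joined by a
  chord.\<close>

lemma clique_monophonic_position:
  assumes "clique G K"
  shows "monophonic_position G K"
  unfolding monophonic_position_def
proof (intro conjI allI impI)
  show "K \<subseteq> verts G" using assms by (simp add: clique_def)
  fix p assume p: "monophonic_path G p"
  then have d: "distinct p" by (simp add: monophonic_path_def is_path_def)
  show "card (set p \<inter> K) \<le> 2"
  proof (rule ccontr)
    assume "\<not> ?thesis"
    then obtain i j k where ijk: "i < j" "j < k" "k < length p" "p ! i \<in> K" "p ! k \<in> K"
      using three_on_path[OF d] by metis
    then have "p ! i \<noteq> p ! k" using d by (simp add: nth_eq_iff_index_eq)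
    then have "{p ! i, p ! k} \<in> edges G" using assms ijk by (auto simp: clique_def)
    then show False using p ijk by (auto simp: monophonic_path_def)
  qed
qed

text \<open>Of three vertices of \<open>X\<close> on an induced path, the first is followed by a
  vertex outside \<open>X\<close>, which is adjacent to the last of the three. The middle one comes
  later than this successor, so that edge is a chord.\<close>

lemma part_monophonic_position:
  assumes G: "complete_multipartite G P" and X: "X \<in> P"
  shows "monophonic_position G X"
  unfolding monophonic_position_def
proof (intro conjI allI impI)
  have part: "partition_on (verts G) P"
    and E: "edges G = {{u, v} | u v. u \<in> verts G \<and> v \<in> verts G \<and> \<not> (\<exists>X \<in> P. u \<in> X \<and> v \<in> X)}"
    using G by (auto simp: complete_multipartite_def)
  show XV: "X \<subseteq> verts G" using part X by (auto simp: partition_on_def)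
  have disj: "Y = X" if "Y \<in> P" "x \<in> X" "x \<in> Y" for Y x
    using that X part by (meson partition_onD2 disjointD disjoint_iff)
  have adj: "{u, v} \<in> edges G" if "u \<in> verts G" "u \<notin> X" "v \<in> X" for u v
    unfolding E using that XV disj by fastforce
  have nadj: "{u, v} \<notin> edges G" if "u \<in> X" "v \<in> X" for u v
    unfolding E using that X by (auto simp: doubleton_eq_iff)
  fix p assume p: "monophonic_path G p"
  then have d: "distinct p" and pV: "set p \<subseteq> verts G"
    by (auto simp: monophonic_path_def is_path_def)
  show "card (set p \<inter> X) \<le> 2"
  proof (rule ccontr)
    assume "\<not> ?thesis"
    then obtain i j k where ijk: "i < j" "j < k" "k < length p"
        and in_X: "p ! i \<in> X" "p ! j \<in> X" "p ! k \<in> X"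
      using three_on_path[OF d] by metis
    have "{p ! i, p ! (i + 1)} \<in> edges G"
      using p ijk by (auto simp: monophonic_path_def is_path_def)
    then have nX: "p ! (i + 1) \<notin> X" using nadj in_X by blast
    then have "i + 1 \<noteq> j" using in_X by metis
    then have lt: "i + 1 + 1 < k" using ijk by linarith
    have "p ! (i + 1) \<in> verts G" using pV lt ijk by (auto simp: subset_eq)
    then have "{p ! (i + 1), p ! k} \<in> edges G" using adj nX in_X by blast
    then show False using p lt ijk unfolding monophonic_path_def by blast
  qed
qed

lemma finite_monophonic_position_cards:
  assumes "simple_graph G"
  shows "finite {card S | S. monophonic_position G S}"
proof -
  have "{card S | S. monophonic_position G S} \<subseteq> card ` Pow (verts G)"
    by (auto simp: monophonic_position_def)
  then show ?thesis using assms by (meson finite_Pow_iff finite_imageI finite_subset simple_graph_def)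
qed

lemma card_le_mp:
  assumes "simple_graph G" "monophonic_position G S"
  shows "card S \<le> mp G"
  unfolding mp_def using finite_monophonic_position_cards[OF assms(1)] assms(2)
  by (intro Max_ge) auto

lemma mp_le:
  assumes "simple_graph G" "\<And>S. monophonic_position G S \<Longrightarrow> card S \<le> m"
  shows "mp G \<le> m"
proof -
  \<comment> \<open>The empty clique makes the set of sizes nonempty, so that \<open>Max\<close> is
    meaningful.\<close>
  have "clique G {}" by (simp add: clique_def)
  then have "{card S | S. monophonic_position G S} \<noteq> {}"
    using clique_monophonic_position by blast
  then show ?thesis
    unfolding mp_def using finite_monophonic_position_cards[OF assms(1)] assms(2)
    by (subst Max_le_iff) auto
qed

section \<open>The strict upper bound\<close>

text \<open>At equality \<open>G\<close> would itself be extremal, hence complete multipartite with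
  at most \<open>a\<close> parts. Each part, being in monophonic position, has at most
  \<open>a\<close> vertices, which contradicts \<open>n > a\<^sup>2\<close>.\<close>

lemma graph_size_less_turan_size:
  fixes G :: "'a ugraph"
  assumes a: "1 \<le> a" "a\<^sup>2 + 1 \<le> n" and G: "simple_graph G" "graph_order G = n" "mp G = a"
  shows "graph_size G < turan_size n a"
proof -
  have an: "a \<le> n" using a by (metis add_leD1 le_trans power2_nat_le_imp_le)
  have free: "\<forall>K. clique G K \<longrightarrow> card K \<le> a"
    using card_le_mp[OF G(1) clique_monophonic_position] G(3) by auto
  let ?Q = "\<lambda>H :: 'a ugraph. simple_graph H \<and> verts H = verts G \<and> (\<forall>K. clique H K \<longrightarrow> card K \<le> a)"
  \<comment> \<open>The trivial bound on sizes guarantees that a largest competitor exists.\<close>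
  have "graph_size H < Suc (n choose 2)" if "?Q H" for H
    using that graph_size_le_choose[of H] G(2) by (simp add: graph_order_def)
  then have "\<exists>H. ?Q H \<and> (\<forall>H'. ?Q H' \<longrightarrow> graph_size H' \<le> graph_size H)"
    by (intro ex_has_greatest_nat[of ?Q G]) (use G(1) free in auto)
  then obtain H where H: "?Q H" "\<And>H'. ?Q H' \<Longrightarrow> graph_size H' \<le> graph_size H" by blast
  then have "extremal a H" by (auto simp: extremal_def)
  then obtain P where "complete_multipartite H P" "card P \<le> a"
    by (rule extremal_complete_multipartite)
  then have Ht: "graph_size H \<le> turan_size n a"
    using H G(2) by (intro complete_multipartite_size_le_turan[OF a(1) an]) (auto simp: graph_order_def)
  have GH: "graph_size G \<le> graph_size H" using H G(1) free by blast
  have "graph_size G \<noteq> turan_size n a"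
  proof
    assume "graph_size G = turan_size n a"
    then have "extremal a G"
      unfolding extremal_def using G(1) free H Ht by (metis le_trans)
    then obtain P where P: "complete_multipartite G P" "card P \<le> a"
      by (rule extremal_complete_multipartite)
    have fin: "finite (verts G)" and part: "partition_on (verts G) P"
      using P by (auto simp: complete_multipartite_def simple_graph_def)
    have finX: "finite X" if "X \<in> P" for X
      using that fin part by (auto simp: partition_on_def intro: finite_subset)
    have "n = (\<Sum>X\<in>P. card X)"
      using product_partition[OF part finX] G(2) by (simp add: graph_order_def)
    also have "\<dots> \<le> (\<Sum>X\<in>P. a)"
      using card_le_mp[OF G(1) part_monophonic_position[OF P(1)]] G(3) by (intro sum_mono) auto
    also have "\<dots> \<le> a * a" using P(2) by simp
    finally show False using a(2) by (simp add: power2_eq_square)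
  qed
  then show ?thesis using GH Ht by linarith
qed

section \<open>Checking explicit induced paths\<close>

lemma monophonic_path_single: "monophonic_path G [x] \<longleftrightarrow> x \<in> verts G"
  by (auto simp: monophonic_path_def is_path_def)

text \<open>Peels off one vertex at a time, so that together with
  \<open>monophonic_path_single\<close> the simplifier can verify an explicitly listed path.\<close>

lemma monophonic_path_Cons:
  "monophonic_path G (x # y # ps) \<longleftrightarrow> x \<in> verts G \<and> x \<notin> set (y # ps) \<and> {x, y} \<in> edges G \<and>
     (\<forall>z\<in>set ps. {x, z} \<notin> edges G) \<and> monophonic_path G (y # ps)"
proof -
  let ?q = "y # ps" and ?E = "edges G"
  have split: "(\<forall>i. Q i) \<longleftrightarrow> Q 0 \<and> (\<forall>i. Q (Suc i))" for Q :: "nat \<Rightarrow> bool"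
    by (metis not0_implies_Suc)
  have consec: "(\<forall>i. i + 1 < length (x # ?q) \<longrightarrow> {(x # ?q) ! i, (x # ?q) ! (i + 1)} \<in> ?E) \<longleftrightarrow>
      {x, y} \<in> ?E \<and> (\<forall>i. i + 1 < length ?q \<longrightarrow> {?q ! i, ?q ! (i + 1)} \<in> ?E)"
    (is "(\<forall>i. ?Q i) \<longleftrightarrow> _")
    by (rule trans[OF split[of ?Q]]) simp
  define Q where "Q i j \<longleftrightarrow> (i + 1 < j \<and> j < length (x # ?q) \<longrightarrow> {(x # ?q) ! i, (x # ?q) ! j} \<notin> ?E)"
    for i j
  have chord: "(\<forall>i j. i + 1 < j \<and> j < length (x # ?q) \<longrightarrow> {(x # ?q) ! i, (x # ?q) ! j} \<notin> ?E) \<longleftrightarrow>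
      (\<forall>z\<in>set ps. {x, z} \<notin> ?E) \<and>
      (\<forall>i j. i + 1 < j \<and> j < length ?q \<longrightarrow> {?q ! i, ?q ! j} \<notin> ?E)"
  proof -
    \<comment> \<open>At positions 0 and 1 the chord condition for the head is vacuous, so it starts
      at position 2, where \<open>ps\<close> begins.\<close>
    have "Q 0 0" "Q 0 (Suc 0)" by (simp_all add: Q_def)
    then have "(\<forall>j. Q 0 j) \<longleftrightarrow> (\<forall>j. Q 0 (Suc (Suc j)))"
      using split[of "Q 0"] split[of "\<lambda>j. Q 0 (Suc j)"] by blast
    moreover have "\<dots> \<longleftrightarrow> (\<forall>z\<in>set ps. {x, z} \<notin> ?E)"
      by (simp add: Q_def all_set_conv_all_nth)
    moreover have "(\<forall>j. Q (Suc i) j) \<longleftrightarrow> (\<forall>j. i + 1 < j \<and> j < length ?q \<longrightarrow> {?q ! i, ?q ! j} \<notin> ?E)" for i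
      by (rule trans[OF split[of "Q (Suc i)"]]) (simp add: Q_def)
    ultimately have "(\<forall>i j. Q i j) \<longleftrightarrow> (\<forall>z\<in>set ps. {x, z} \<notin> ?E) \<and>
        (\<forall>i j. i + 1 < j \<and> j < length ?q \<longrightarrow> {?q ! i, ?q ! j} \<notin> ?E)"
      by (intro trans[OF split[of "\<lambda>i. \<forall>j. Q i j"]]) simp
    then show ?thesis by (simp only: Q_def)
  qed
  show ?thesis
    unfolding monophonic_path_def is_path_def consec chord by auto
qed

section \<open>The punctured Turan graph and its mp-number\<close>

text \<open>Vertex \<open>v\<close> lies in part \<open>v mod a\<close> and row \<open>v div a\<close>; the rows below \<open>n div a\<close> are
  full, and exactly these are made independent.\<close>

definition punctured_turan :: "nat \<Rightarrow> nat \<Rightarrow> nat ugraph" where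
  "punctured_turan n a = \<lparr>verts = {..<n}, edges = {{u, v} | u v. u < n \<and> v < n \<and> u mod a \<noteq> v mod a \<and>
     (u div a = v div a \<longrightarrow> n div a \<le> u div a)}\<rparr>"

lemma punctured_turan_verts: "verts (punctured_turan n a) = {..<n}"
  by (simp add: punctured_turan_def)

lemma punctured_turan_edge_iff:
  "{u, v} \<in> edges (punctured_turan n a) \<longleftrightarrow> u < n \<and> v < n \<and> u mod a \<noteq> v mod a \<and>
     (u div a = v div a \<longrightarrow> n div a \<le> u div a)"
  by (auto simp: punctured_turan_def doubleton_eq_iff)

lemma simple_graph_punctured_turan: "simple_graph (punctured_turan n a)"
  by (auto simp: simple_graph_def punctured_turan_def card_insert_if)

text \<open>Every cell of a full row is occupied; the auxiliary vertices \<open>j * a + i\<close> of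
  the constructed paths come from here.\<close>

lemma row_position:
  fixes a :: nat
  assumes "i < a" "j < n div a"
  shows "j * a + i < n" "(j * a + i) div a = j" "(j * a + i) mod a = i"
proof -
  have "Suc j * a \<le> n div a * a" using assms by (intro mult_le_mono1) simp
  also have "\<dots> \<le> n" by simp
  finally show "j * a + i < n" using assms by simp
qed (use assms in auto)

lemma not_monophonic_position:
  assumes "monophonic_path G p" "{x, y, z} \<subseteq> set p" "{x, y, z} \<subseteq> S" "x \<noteq> y" "x \<noteq> z" "y \<noteq> z"
  shows "\<not> monophonic_position G S"
proof
  assume "monophonic_position G S"
  then have "card (set p \<inter> S) \<le> 2" using assms(1) by (simp add: monophonic_position_def)
  moreover have "card {x, y, z} \<le> card (set p \<inter> S)" using assms by (intro card_mono) auto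
  ultimately show False using assms by simp
qed

text \<open>In another column, \<open>v\<close> is taken in the row of \<open>x\<close> and
  \<open>w\<close> in the row of \<open>y\<close>. As these rows are full, \<open>v\<close> misses
  \<open>x\<close> and \<open>w\<close> misses \<open>y\<close>, which makes the path
  \<open>x, w, z, v, y\<close> induced. The vertex \<open>z\<close> may lie in the incomplete
  row.\<close>

lemma same_part_path:
  fixes a n :: nat
  defines "G \<equiv> punctured_turan n a"
  assumes a: "2 \<le> a" and n: "x < n" "y < n" "z < n"
    and mod: "x mod a = y mod a" "z mod a = y mod a"
    and ne: "x \<noteq> y" "x \<noteq> z" "y \<noteq> z"
    and row: "x div a < n div a" "y div a < n div a"
  shows "\<exists>p. monophonic_path G p \<and> {x, y, z} \<subseteq> set p"
proof -
  obtain l where l: "l < a" "l \<noteq> y mod a"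
  proof
    show "(if y mod a = 0 then 1 else 0) < a" using a by simp
    show "(if y mod a = 0 then 1 else 0) \<noteq> y mod a" by simp
  qed
  define v w where "v = x div a * a + l" and "w = y div a * a + l"
  note v = row_position[OF l(1) row(1), folded v_def]
  note w = row_position[OF l(1) row(2), folded w_def]
  have div: "x div a \<noteq> y div a" "x div a \<noteq> z div a" "y div a \<noteq> z div a"
    using mod ne by (metis div_mult_mod_eq)+
  have nv: "x \<noteq> v" "x \<noteq> w" "z \<noteq> v" "z \<noteq> w" "y \<noteq> v" "y \<noteq> w"
    using v(3) w(3) mod l(2) by metis+
  have vw: "v \<noteq> w" using v(2) w(2) div(1) by metis
  have "monophonic_path G [x, w, z, v, y]"
    unfolding G_def using n v w l(2) mod ne div row nv vw nv[symmetric] vw[symmetric]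
    by (simp add: monophonic_path_Cons monophonic_path_single punctured_turan_edge_iff
        punctured_turan_verts)
  then show ?thesis by (intro exI[of _ "[x, w, z, v, y]"]) auto
qed

text \<open>Vertices \<open>x\<close> and \<open>z\<close> in different columns can be nonadjacent
  only in a common full row. The path then depends on whether the row of \<open>y\<close> is full
  and whether the column of \<open>x\<close> contains a third vertex.\<close>

lemma two_part_path:
  fixes a n :: nat
  defines "G \<equiv> punctured_turan n a"
  assumes a: "2 \<le> a" "a\<^sup>2 + 1 \<le> n" and n: "x < n" "y < n" "z < n"
    and mod: "x mod a = y mod a" "z mod a \<noteq> y mod a" and ne: "x \<noteq> y"
    and xz: "{x, z} \<notin> edges G"
  shows "\<exists>p. monophonic_path G p \<and> {x, y, z} \<subseteq> set p"
proof -
  let ?q = "n div a"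
  have lt: "x mod a < a" "z mod a < a" using a by auto
  have q: "a \<le> ?q" using a by (simp add: power2_eq_square less_eq_div_iff_mult_less_eq)
  have div: "x div a = z div a" "x div a < ?q"
    using xz n mod unfolding G_def punctured_turan_edge_iff by auto
  have xy: "x div a \<noteq> y div a" using mod ne by (metis div_mult_mod_eq)
  note simps = monophonic_path_Cons monophonic_path_single punctured_turan_edge_iff
    punctured_turan_verts
  show ?thesis
  proof (cases "y div a < ?q")
    case False
    \<comment> \<open>Any full row other than that of \<open>x\<close>. There the column of
      \<open>z\<close> has a vertex \<open>w\<close> adjacent to both \<open>x\<close> and
      \<open>y\<close>.\<close>
    define j where "j = (if x div a = 0 then 1 else 0 :: nat)"
    have j: "j < ?q" "j \<noteq> x div a" using q a by (auto simp: j_def)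
    define w where "w = j * a + z mod a"
    note w = row_position[OF lt(2) j(1), folded w_def]
    have "monophonic_path G [z, y, w, x]"
      unfolding G_def using n w j mod ne div xy False by (auto simp: simps)
    then show ?thesis by (intro exI[of _ "[z, y, w, x]"]) auto
  next
    case True
    \<comment> \<open>In the row of \<open>y\<close> and the column of \<open>z\<close>: adjacent to
      \<open>x\<close>, but neither to \<open>y\<close> nor to \<open>z\<close>.\<close>
    define v where "v = y div a * a + z mod a"
    note v = row_position[OF lt(2) True, folded v_def]
    show ?thesis
    proof (cases "\<exists>u < n. u mod a = x mod a \<and> u div a \<noteq> x div a \<and> u div a \<noteq> y div a")
      case True
      then obtain u where u: "u < n" "u mod a = x mod a" "u div a \<noteq> x div a" "u div a \<noteq> y div a"
        by blast
      have "monophonic_path G [x, v, u, z, y]"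
        unfolding G_def using n u v mod ne div xy \<open>y div a < ?q\<close> by (auto simp: simps)
      then show ?thesis by (intro exI[of _ "[x, v, u, z, y]"]) auto
    next
      case False
      \<comment> \<open>With three full rows, one avoids the rows of \<open>x\<close> and
        \<open>y\<close> and provides a third vertex in their column.\<close>
      have "\<not> 3 \<le> ?q"
      proof
        assume q3: "3 \<le> ?q"
        have "\<exists>m < 3. m \<noteq> i \<and> m \<noteq> j" for i j :: nat by presburger
        then obtain m where "m < 3" "m \<noteq> x div a" "m \<noteq> y div a" by blast
        then have "m < ?q" "m \<noteq> x div a" "m \<noteq> y div a" using q3 by auto
        then show False using False row_position[OF lt(1)] by metis
      qed
      \<comment> \<open>The only case in which a part may consist of just two vertices is \<open>n = 5\<close>, \<open>a = 2\<close>; the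
        fifth vertex, outside the full rows, then serves as a detour.\<close>
      then have a2: "a = 2" and q2: "n div a = 2" using q a by linarith+
      then have n5: "n = 5" using a by simp
      \<comment> \<open>Otherwise vertex 4, alone in row 2, would be a third vertex in the column of
        \<open>x\<close>.\<close>
      have "x mod 2 \<noteq> 0"
      proof
        assume "x mod 2 = 0"
        then have "(4::nat) < n \<and> 4 mod a = x mod a \<and> 4 div a \<noteq> x div a \<and> 4 div a \<noteq> y div a"
          using div(2) \<open>y div a < ?q\<close> unfolding a2 n5 by simp
        then show False using False by blast
      qed
      then have "monophonic_path G [x, 4, y, z]"
        unfolding G_def using n mod ne div xy True q2 unfolding a2 n5
        by (auto simp: simps)
      then show ?thesis by (intro exI[of _ "[x, 4, y, z]"]) auto
    qed
  qed
qed

lemma mp_punctured_turan: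
  assumes a: "2 \<le> a" "a\<^sup>2 + 1 \<le> n"
  shows "mp (punctured_turan n a) = a"
proof (rule antisym)
  let ?G = "punctured_turan n a" and ?q = "n div a"
  show "mp ?G \<le> a"
  proof (rule mp_le[OF simple_graph_punctured_turan], rule ccontr)
    fix S assume S: "monophonic_position ?G S" and "\<not> card S \<le> a"
    then have Sn: "S \<subseteq> {..<n}" and card: "a < card S"
      by (auto simp: monophonic_position_def punctured_turan_verts)
    \<comment> \<open>Pigeonhole: more than \<open>a\<close> vertices are spread over
      \<open>a\<close> columns.\<close>
    have "card ((\<lambda>x. x mod a) ` S) \<le> card {..<a}"
      using a by (intro card_mono) auto
    then have "\<not> inj_on (\<lambda>x. x mod a) S" using card by (intro pigeonhole) simp
    then obtain x y where xy: "x \<in> S" "y \<in> S" "x \<noteq> y" "x mod a = y mod a"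
      by (auto simp: inj_on_def)
    have "\<not> S \<subseteq> {x, y}"
      using card a xy(3) card_mono[of "{x, y}" S] by auto
    then obtain z where z: "z \<in> S" "x \<noteq> z" "y \<noteq> z" by auto
    have n: "x < n" "y < n" "z < n" using Sn xy z by auto
    have "\<exists>p. monophonic_path ?G p \<and> {x, y, z} \<subseteq> set p"
    proof (cases "z mod a = y mod a")
      case True
      have le: "x div a \<le> ?q" "y div a \<le> ?q" "z div a \<le> ?q" using n by (auto intro: div_le_mono)
      have "x div a \<noteq> y div a" "x div a \<noteq> z div a" "y div a \<noteq> z div a"
        using xy z True by (metis div_mult_mod_eq)+
      \<comment> \<open>At most one of three distinct rows is the incomplete row \<open>?q\<close>,
        so two of the vertices lie in full rows, as \<open>same_part_path\<close> requires of its
        first two.\<close>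
      then consider "x div a < ?q" "y div a < ?q" | "x div a < ?q" "z div a < ?q"
        | "y div a < ?q" "z div a < ?q" using le by linarith
      then show ?thesis
      proof cases
        case 1
        then show ?thesis by (intro same_part_path) (use a n xy z True in auto)
      next
        case 2
        then have "\<exists>p. monophonic_path ?G p \<and> {x, z, y} \<subseteq> set p"
          by (intro same_part_path) (use a n xy z True in auto)
        then show ?thesis by (simp add: conj_commute)
      next
        case 3
        then have "\<exists>p. monophonic_path ?G p \<and> {y, z, x} \<subseteq> set p"
          by (intro same_part_path) (use a n xy z True in auto)
        then show ?thesis by (simp add: conj_ac)
      qed
    next
      case False
      \<comment> \<open>If \<open>z\<close> is adjacent to both \<open>x\<close> and
        \<open>y\<close>, then \<open>x, z, y\<close> is already induced. Otherwise
        \<open>two_part_path\<close> applies to whichever of the two is not adjacent to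
        \<open>z\<close>.\<close>
      show ?thesis
      proof (cases "{x, z} \<in> edges ?G \<and> {y, z} \<in> edges ?G")
        case True
        then have "monophonic_path ?G [x, z, y]"
          using n xy z
          by (auto simp: monophonic_path_Cons monophonic_path_single punctured_turan_edge_iff
              punctured_turan_verts)
        then show ?thesis by (intro exI[of _ "[x, z, y]"]) auto
      next
        case nadj: False
        show ?thesis
        proof (cases "{x, z} \<in> edges ?G")
          case False
          show ?thesis
            by (intro two_part_path) (use a n xy \<open>z mod a \<noteq> y mod a\<close> False in auto)
        next
          case True
          have "\<exists>p. monophonic_path ?G p \<and> {y, x, z} \<subseteq> set p"
            by (intro two_part_path) (use a n xy \<open>z mod a \<noteq> y mod a\<close> nadj True in auto)
          then show ?thesis by (simp add: conj_ac)
        qed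
      qed
    qed
    then obtain p where "monophonic_path ?G p" "{x, y, z} \<subseteq> set p" by blast
    then have "\<not> monophonic_position ?G S"
      by (rule not_monophonic_position) (use xy z in auto)
    then show False using S by blast
  qed
  \<comment> \<open>At least \<open>a\<close> rows are full, so the diagonal of length
    \<open>a\<close> fits into them; its cells differ pairwise in row and column.\<close>
  have q: "a \<le> ?q" using a by (simp add: power2_eq_square less_eq_div_iff_mult_less_eq)
  let ?d = "\<lambda>i. i * a + i"
  note d = row_position[OF _ less_le_trans[OF _ q]]
  have "clique ?G (?d ` {..<a})"
    using d by (auto simp: clique_def punctured_turan_edge_iff punctured_turan_verts)
  then have "card (?d ` {..<a}) \<le> mp ?G"
    by (intro card_le_mp simple_graph_punctured_turan clique_monophonic_position)
  moreover have "inj_on ?d {..<a}" using d(2) by (intro inj_onI) (metis lessThan_iff)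
  ultimately show "a \<le> mp ?G" by (simp add: card_image)
qed

text \<open>Every deleted edge is a pair inside a full row \<open>{j * a..<j * a + a}\<close>. Only
  an upper bound on the loss is needed, so a union bound suffices.\<close>

lemma turan_size_le_punctured_turan_size:
  assumes a: "1 \<le> a" "a \<le> n"
  shows "turan_size n a \<le> graph_size (punctured_turan n a) + n div a * (a choose 2)"
proof -
  let ?q = "n div a" and ?G = "punctured_turan n a"
  let ?E = "{{u, v} | u v. u < n \<and> v < n \<and> u mod a \<noteq> v mod a}"
  let ?R = "\<lambda>j. {e. e \<subseteq> {j * a..<j * a + a} \<and> card e = 2}"
  have row: "u \<in> {u div a * a..<u div a * a + a}" for u
    using a div_mult_mod_eq[of u a] mod_less_divisor[of a u] unfolding atLeastLessThan_iff by linarith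
  have "?E \<subseteq> edges ?G \<union> (\<Union>j<?q. ?R j)"
  proof
    fix e assume "e \<in> ?E"
    then obtain u v where uv: "e = {u, v}" "u < n" "v < n" "u mod a \<noteq> v mod a" by blast
    show "e \<in> edges ?G \<union> (\<Union>j<?q. ?R j)"
    proof (cases "u div a = v div a \<and> u div a < ?q")
      case True
      have "u \<noteq> v" using uv(4) by blast
      then have "e \<in> ?R (u div a)" using row[of u] row[of v] uv(1) True by simp
      then show ?thesis using True by blast
    next
      case False
      then show ?thesis using uv by (auto simp: punctured_turan_edge_iff)
    qed
  qed
  then have "card ?E \<le> card (edges ?G \<union> (\<Union>j<?q. ?R j))"
    using simple_graph_finite_edges[OF simple_graph_punctured_turan] by (intro card_mono) auto
  also have "\<dots> \<le> card (edges ?G) + card (\<Union>j<?q. ?R j)" by (rule card_Un_le)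
  also have "card (\<Union>j<?q. ?R j) \<le> (\<Sum>j<?q. card (?R j))" by (rule card_UN_le) simp
  also have "\<dots> = ?q * (a choose 2)" by (simp add: n_subsets)
  finally show ?thesis
    using turan_size_eq[OF a turan_graph_exists[OF a]] by (simp add: graph_size_def)
qed

section \<open>The bounds on \<open>mex\<close> and its asymptotics\<close>

lemma finite_graph_sizes:
  "finite {graph_size G | G :: nat ugraph. simple_graph G \<and> graph_order G = n \<and> mp G = a}"
  by (rule finite_subset[of _ "{..n choose 2}"]) (use graph_size_le_choose in auto)

lemma turan_size_le_mex:
  assumes a: "2 \<le> a" "a\<^sup>2 + 1 \<le> n"
  shows "turan_size n a \<le> mex n a + n div a * (a choose 2)"
proof -
  have an: "1 \<le> a" "a \<le> n" using a power2_nat_le_imp_le[of a n] by auto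
  have "graph_size (punctured_turan n a) \<le> mex n a"
    unfolding mex_def using mp_punctured_turan[OF a] simple_graph_punctured_turan finite_graph_sizes
    by (intro Max_ge) (force simp: graph_order_def punctured_turan_verts)+
  then show ?thesis using turan_size_le_punctured_turan_size[OF an] by linarith
qed

text \<open>The graph \<open>punctured_turan n a\<close> shows that the set of sizes is nonempty;
  hence the maximum is attained, and the strict bound for a single graph applies.\<close>

lemma mex_less_turan_size:
  assumes a: "2 \<le> a" "a\<^sup>2 + 1 \<le> n"
  shows "mex n a < turan_size n a"
proof -
  let ?A = "{graph_size G | G :: nat ugraph. simple_graph G \<and> graph_order G = n \<and> mp G = a}"
  have "graph_size (punctured_turan n a) \<in> ?A"
    using mp_punctured_turan[OF a] simple_graph_punctured_turan
    by (force simp: graph_order_def punctured_turan_verts)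
  then have "Max ?A \<in> ?A" using finite_graph_sizes by (intro Max_in) auto
  then obtain G :: "nat ugraph" where
    G: "Max ?A = graph_size G" "simple_graph G" "graph_order G = n" "mp G = a" by blast
  then have "mex n a = graph_size G" by (simp add: mex_def)
  then show ?thesis using graph_size_less_turan_size[OF _ a(2) G(2-4)] a(1) by simp
qed

text \<open>Isolates the main term: with \<open>r = n mod a\<close>, the correction
  \<open>r (a - r) / (2 a)\<close> stays bounded for fixed \<open>a\<close>.\<close>

lemma turan_size_closed_form:
  assumes a: "1 \<le> a" "a \<le> n"
  shows "real (turan_size n a) =
    (1 - 1 / real a) * ((real n)\<^sup>2 / 2) - real (n mod a) * (real a - real (n mod a)) / (2 * real a)"
proof -
  let ?q = "n div a" and ?r = "n mod a"
  have c2: "real (m choose 2) = real m * (real m - 1) / 2" for m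
    by (induction m) (auto simp: numeral_2_eq_2 field_simps)
  have "turan_size n a + (a * (?q choose 2) + ?q * ?r) = n choose 2"
    using turan_graph_size[OF a(1) turan_graph_exists[OF a]]
      turan_size_eq[OF a turan_graph_exists[OF a]] by simp
  then have "real (turan_size n a) = real (n choose 2) - (real a * real (?q choose 2) + real ?q * real ?r)"
    by (metis add_diff_cancel_right' of_nat_add of_nat_mult)
  moreover have n: "real n = real a * real ?q + real ?r"
    by (metis mult_div_mod_eq of_nat_add of_nat_mult)
  ultimately have "real (turan_size n a) =
      ((real n)\<^sup>2 - (real a * (real ?q)\<^sup>2 + 2 * real ?q * real ?r) - real ?r) / 2"
    unfolding c2 by (simp add: field_simps power2_eq_square)
  \<comment> \<open>Eliminates the quotient \<open>?q\<close> in favour of \<open>n\<close> and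
    \<open>?r\<close>.\<close>
  moreover have "((real n)\<^sup>2 - (real ?r)\<^sup>2) / real a = real a * (real ?q)\<^sup>2 + 2 * real ?q * real ?r"
    using a(1) unfolding n by (simp add: field_simps power2_eq_square)
  ultimately have "real (turan_size n a) =
      ((real n)\<^sup>2 - ((real n)\<^sup>2 - (real ?r)\<^sup>2) / real a - real ?r) / 2" by (simp only:)
  also have "\<dots> = (1 - 1 / real a) * ((real n)\<^sup>2 / 2) - real ?r * (real a - real ?r) / (2 * real a)"
    using a(1) by (simp add: field_simps power2_eq_square)
  finally show ?thesis .
qed

lemma mex_asymp_equiv:
  assumes a: "2 \<le> a"
  shows "(\<lambda>n. real (mex n a)) \<sim>[at_top] (\<lambda>n. (1 - 1 / real a) * ((real n)\<^sup>2 / 2))"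
proof (rule smallo_imp_asymp_equiv)
  let ?f = "\<lambda>n. (1 - 1 / real a) * ((real n)\<^sup>2 / 2)"
  \<comment> \<open>One \<open>a * n\<close> covers the edges deleted in full rows, the other the
    correction in the closed form, which is at most \<open>a\<close>.\<close>
  have bound: "norm (real (mex n a) - ?f n) \<le> 2 * real a * norm (real n)" if n: "a\<^sup>2 + 1 \<le> n" for n
  proof -
    have an: "1 \<le> a" "a \<le> n" using a n power2_nat_le_imp_le[of a n] by auto
    let ?e = "real (n mod a) * (real a - real (n mod a)) / (2 * real a)"
    have r: "real (n mod a) \<le> real a" using an by simp
    then have e0: "0 \<le> ?e" by simp
    have "?e \<le> real a * real a / (2 * real a)"
      using r an by (intro divide_right_mono mult_mono) auto
    also have "\<dots> \<le> real a" using an by simp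
    finally have e1: "?e \<le> real a" .
    have "real (n div a * (a choose 2)) \<le> real a * real n"
    proof -
      have "2 * (a choose 2) \<le> a * a" 
        using div_times_less_eq_dividend[of "a * (a - 1)" 2] mult_le_mono2[of "a - 1" a a]
        unfolding choose_two by linarith
      then have "n div a * (a choose 2) \<le> n div a * (a * a)" by (intro mult_le_mono2) linarith
      also have "\<dots> \<le> a * n" by (metis div_times_less_eq_dividend mult.assoc mult.commute mult_le_mono2)
      finally show ?thesis by (metis of_nat_le_iff of_nat_mult)
    qed
    moreover have "real (turan_size n a) \<le> real (mex n a) + real (n div a * (a choose 2))"
      using turan_size_le_mex[OF a n] by (metis of_nat_add of_nat_le_iff)
    moreover have "real (mex n a) \<le> real (turan_size n a)"
      using mex_less_turan_size[OF a n] by simp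
    moreover have "real a \<le> real a * real n" using an by simp
    moreover have "0 \<le> real a * real n" by simp
    ultimately show ?thesis
      using turan_size_closed_form[OF an] e0 e1 by (simp add: abs_le_iff)
  qed
  have "(\<lambda>n. real (mex n a) - ?f n) \<in> O(\<lambda>n. real n)"
    by (rule bigoI[of _ "2 * real a"], rule eventually_mono[OF eventually_ge_at_top[of "a\<^sup>2 + 1"]])
      (rule bound)
  also have "(\<lambda>n. real n) \<in> o(\<lambda>n. (real n)\<^sup>2)" by real_asymp
  \<comment> \<open>The factor \<open>1 - 1 / a\<close> is nonzero because
    \<open>a \<ge> 2\<close>.\<close>
  also have "(\<lambda>n. (real n)\<^sup>2) \<in> \<Theta>(?f)" using a by simp
  finally show "(\<lambda>n. real (mex n a) - ?f n) \<in> o(?f)" .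
qed

theorem theorem3p5:
  fixes a :: nat
  assumes "a \<ge> 2"
  shows "(\<forall>n::nat. n \<ge> a\<^sup>2 + 1 \<longrightarrow>
           int (turan_size n a) - \<lfloor>real n / real a\<rfloor> * int (a choose 2) \<le> int (mex n a) \<and>
           int (mex n a) \<le> int (turan_size n a) - 1) \<and>
         (\<lambda>n. real (mex n a)) \<sim>[at_top] (\<lambda>n. (1 - 1 / real a) * ((real n)\<^sup>2 / 2))"
proof (intro conjI allI impI mex_asymp_equiv[OF assms])
  fix n :: nat assume n: "n \<ge> a\<^sup>2 + 1"
  have "int (turan_size n a) \<le> int (mex n a) + int (n div a) * int (a choose 2)"
    using turan_size_le_mex[OF assms n] by (metis of_nat_add of_nat_le_iff of_nat_mult)
  moreover have "\<lfloor>real n / real a\<rfloor> = int (n div a)" by (rule floor_divide_of_nat_eq)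
  ultimately show "int (turan_size n a) - \<lfloor>real n / real a\<rfloor> * int (a choose 2) \<le> int (mex n a)"
    by simp
  show "int (mex n a) \<le> int (turan_size n a) - 1"
    using mex_less_turan_size[OF assms n] by simp
qed

end
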